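(* The relation $\ulcorner\!\urcorner$ of adequality on the hyperreal field ${}^{\ast}\mathbb{R}$ is multiplicatively invariant in the following sense: let $P$ and $Q$ be (the values in ${}^{\ast}\mathbb{R}$ of) polynomials or more general expressions, i.e. arbitrary elements $P,Q\in{}^{\ast}\mathbb{R}$, and let $E\in{}^{\ast}\mathbb{R}$ with $E\neq 0$. If $P \mathrel{\ulcorner\!\urcorner} Q$, then $\frac{P}{E}\mathrel{\ulcorner\!\urcorner}\frac{Q}{E}$.
   Context: Hyperreal field: let $\xi\colon\mathcal{P}(\mathbb{N})\to\{0,1\}$ be a finitely additive measure taking the value $1$ on each cofinite subset of $\mathbb{N}$ (equivalently, $\mathcal{U}=\{A\subseteq\mathbb{N}:\xi(A)=1\}$ is a free ultrafilter). The field ${}^{\ast}\mathbb{R}=\mathbb{R}^{\mathbb{N}}/\mathrm{MAX}$ is the quotient of the ring of real sequences (with termwise operations) by the maximal ideal $\mathrm{MAX}$ of sequences $(u_n)$ with $\xi(\{n: u_n=0\})=1$. It is totally ordered by $[(u_n)]<[(v_n)]$ if and only if $\xi(\{n:u_n<v_n\})=1$, and $\mathbb{R}$ is embedded in ${}^{\ast}\mathbb{R}$ by constant sequences. An element $\varepsilon\in{}^{\ast}\mathbb{R}$ is infinitesimal if $-r<\varepsilon<r$ for each positive $r\in\mathbb{R}$. Hyperreal numbers $a,b$ are infinitely close, written $a\approx b$, if $a-b$ is infinitesimal. Hyperreal numbers $a,b$ are adequal, written $a\mathrel{\ulcorner\!\urcorner} b$, if either $\frac{a}{b}\approx 1$ (which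 presupposes $b\neq 0$) or $a=b=0$. *)

theory Defs
  imports Complex_Main "HOL-Algebra.QuotRing"
begin

definition free_two_valued_measure :: "(nat set \<Rightarrow> real) \<Rightarrow> bool" where
  "free_two_valued_measure \<xi> \<longleftrightarrow>
     (\<forall>A. \<xi> A \<in> {0, 1}) \<and>
     (\<forall>A B. A \<inter> B = {} \<longrightarrow> \<xi> (A \<union> B) = \<xi> A + \<xi> B) \<and>
     (\<forall>A. finite (- A) \<longrightarrow> \<xi> A = 1)"

definition seq_ring :: "(nat \<Rightarrow> real) ring" where
  "seq_ring = \<lparr>carrier = UNIV, monoid.mult = (\<lambda>u v n. u n * v n), one = (\<lambda>n. 1),
     zero = (\<lambda>n. 0), add = (\<lambda>u v n. u n + v n)\<rparr>"

definition max_ideal :: "(nat set \<Rightarrow> real) \<Rightarrow> (nat \<Rightarrow> real) set" where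
  "max_ideal \<xi> = {u. \<xi> {n. u n = 0} = 1}"

definition hyperreals :: "(nat set \<Rightarrow> real) \<Rightarrow> (nat \<Rightarrow> real) set ring" where
  "hyperreals \<xi> = seq_ring Quot max_ideal \<xi>"

definition hclass :: "(nat set \<Rightarrow> real) \<Rightarrow> (nat \<Rightarrow> real) \<Rightarrow> (nat \<Rightarrow> real) set" where
  "hclass \<xi> u = max_ideal \<xi> +>\<^bsub>seq_ring\<^esub> u"

definition hconst :: "(nat set \<Rightarrow> real) \<Rightarrow> real \<Rightarrow> (nat \<Rightarrow> real) set" where
  "hconst \<xi> r = hclass \<xi> (\<lambda>n. r)"

text \<open>The order does not depend on the chosen representatives; see \<open>hless_hclass_iff\<close> below.\<close>

definition hless :: "(nat set \<Rightarrow> real) \<Rightarrow> (nat \<Rightarrow> real) set \<Rightarrow> (nat \<Rightarrow> real) set \<Rightarrow> bool" where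
  "hless \<xi> a b \<longleftrightarrow>
     (\<exists>u v. a = hclass \<xi> u \<and> b = hclass \<xi> v \<and> \<xi> {n. u n < v n} = 1)"

text \<open>As usual for \<open>m_inv\<close>, the quotient is meaningful only when \<open>b\<close> is a unit of the field,
  that is, nonzero.\<close>

definition hdivide ::
    "(nat set \<Rightarrow> real) \<Rightarrow> (nat \<Rightarrow> real) set \<Rightarrow> (nat \<Rightarrow> real) set \<Rightarrow> (nat \<Rightarrow> real) set" where
  "hdivide \<xi> a b = a \<otimes>\<^bsub>hyperreals \<xi>\<^esub> inv\<^bsub>hyperreals \<xi>\<^esub> b"

definition infinitesimal :: "(nat set \<Rightarrow> real) \<Rightarrow> (nat \<Rightarrow> real) set \<Rightarrow> bool" where
  "infinitesimal \<xi> e \<longleftrightarrow>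
     (\<forall>r::real. r > 0 \<longrightarrow> hless \<xi> (hconst \<xi> (- r)) e \<and> hless \<xi> e (hconst \<xi> r))"

definition infinitely_close ::
    "(nat set \<Rightarrow> real) \<Rightarrow> (nat \<Rightarrow> real) set \<Rightarrow> (nat \<Rightarrow> real) set \<Rightarrow> bool" where
  "infinitely_close \<xi> a b \<longleftrightarrow> infinitesimal \<xi> (a \<ominus>\<^bsub>hyperreals \<xi>\<^esub> b)"

definition adequal ::
    "(nat set \<Rightarrow> real) \<Rightarrow> (nat \<Rightarrow> real) set \<Rightarrow> (nat \<Rightarrow> real) set \<Rightarrow> bool" where
  "adequal \<xi> a b \<longleftrightarrow>
     (b \<noteq> \<zero>\<^bsub>hyperreals \<xi>\<^esub> \<and>
        infinitely_close \<xi> (hdivide \<xi> a b) \<one>\<^bsub>hyperreals \<xi>\<^esub>) \<or>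
     (a = \<zero>\<^bsub>hyperreals \<xi>\<^esub> \<and> b = \<zero>\<^bsub>hyperreals \<xi>\<^esub>)"

context
  fixes \<xi> :: "nat set \<Rightarrow> real"
  assumes \<xi>: "free_two_valued_measure \<xi>"
begin

lemma xi_two_valued: "\<xi> A = 0 \<or> \<xi> A = 1"
  using \<xi> unfolding free_two_valued_measure_def by blast

lemma xi_additive: "A \<inter> B = {} \<Longrightarrow> \<xi> (A \<union> B) = \<xi> A + \<xi> B"
  using \<xi> unfolding free_two_valued_measure_def by blast

lemma xi_mono: "\<xi> A = 1 \<Longrightarrow> A \<subseteq> B \<Longrightarrow> \<xi> B = 1"
proof -
  assume A: "\<xi> A = 1" "A \<subseteq> B"
  have "\<xi> (A \<union> (B - A)) = \<xi> A + \<xi> (B - A)"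
    by (rule xi_additive) blast
  moreover have "A \<union> (B - A) = B" using A by blast
  moreover have "\<xi> B = 0 \<or> \<xi> B = 1" "\<xi> (B - A) = 0 \<or> \<xi> (B - A) = 1"
    by (rule xi_two_valued)+
  ultimately show ?thesis using A by auto
qed

lemma xi_compl: "\<xi> A = 1 \<longleftrightarrow> \<xi> (- A) \<noteq> 1"
proof -
  have "\<xi> (A \<union> - A) = \<xi> A + \<xi> (- A)"
    by (rule xi_additive) simp
  moreover have "\<xi> UNIV = 1" using \<xi> unfolding free_two_valued_measure_def by simp
  moreover have "\<xi> A = 0 \<or> \<xi> A = 1" "\<xi> (- A) = 0 \<or> \<xi> (- A) = 1"
    by (rule xi_two_valued)+
  ultimately show ?thesis by auto
qed

lemma xi_Int: "\<xi> A = 1 \<Longrightarrow> \<xi> B = 1 \<Longrightarrow> \<xi> (A \<inter> B) = 1"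
proof (rule ccontr)
  assume A: "\<xi> A = 1" "\<xi> B = 1" "\<xi> (A \<inter> B) \<noteq> 1"
  have "\<xi> (A \<inter> B \<union> (A - B)) = \<xi> (A \<inter> B) + \<xi> (A - B)"
    by (rule xi_additive) blast
  moreover have "A \<inter> B \<union> (A - B) = A" by blast
  moreover have "\<xi> (A \<inter> B) = 0 \<or> \<xi> (A \<inter> B) = 1"
    by (rule xi_two_valued)
  ultimately have "\<xi> (A - B) = 1" using A by auto
  then have "\<xi> (- B) = 1" by (rule xi_mono) blast
  with A xi_compl show False by blast
qed

lemma xi_UNIV: "\<xi> UNIV = 1"
  using \<xi> unfolding free_two_valued_measure_def by simp

lemma cring_seq_ring: "cring seq_ring"
proof (rule cringI)
  show "abelian_group seq_ring"
  proof (rule abelian_groupI)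
    fix x assume "x \<in> carrier seq_ring"
    show "\<exists>y\<in>carrier seq_ring. y \<oplus>\<^bsub>seq_ring\<^esub> x = \<zero>\<^bsub>seq_ring\<^esub>"
      by (rule bexI[of _ "\<lambda>n. - x n"]) (auto simp: seq_ring_def)
  qed (auto simp: seq_ring_def)
  show "comm_monoid seq_ring"
    by (rule comm_monoidI) (auto simp: seq_ring_def)
qed (auto simp: seq_ring_def distrib_right)

lemma a_inv_seq_ring: "\<ominus>\<^bsub>seq_ring\<^esub> u = (\<lambda>n. - u n)"
proof -
  interpret cring seq_ring by (rule cring_seq_ring)
  show ?thesis
    by (rule minus_equality) (auto simp: seq_ring_def)
qed

lemma ideal_max_ideal: "ideal (max_ideal \<xi>) seq_ring"
proof -
  interpret cring seq_ring by (rule cring_seq_ring)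
  show ?thesis
  proof (rule idealI)
    show "subgroup (max_ideal \<xi>) (add_monoid seq_ring)"
    proof (rule group.subgroupI)
      show "group (add_monoid seq_ring)" by (rule add.group_axioms)
      show "max_ideal \<xi> \<noteq> {}" using xi_UNIV by (auto simp: max_ideal_def intro!: exI[of _ "\<lambda>n. 0"])
      show "inv\<^bsub>add_monoid seq_ring\<^esub> a \<in> max_ideal \<xi>" if "a \<in> max_ideal \<xi>" for a
        using that a_inv_seq_ring[of a] by (simp add: max_ideal_def a_inv_def)
      show "a \<otimes>\<^bsub>add_monoid seq_ring\<^esub> b \<in> max_ideal \<xi>" if "a \<in> max_ideal \<xi>" "b \<in> max_ideal \<xi>" for a b
      proof -
        have *: "\<xi> {n. a n = 0} = 1" "\<xi> {n. b n = 0} = 1"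
          using that by (auto simp: max_ideal_def)
        have "\<xi> {n. a n + b n = 0} = 1"
          by (rule xi_mono[OF xi_Int[OF *]]) auto
        then show ?thesis by (simp add: max_ideal_def seq_ring_def)
      qed
    qed (auto simp: seq_ring_def)
    show "x \<otimes>\<^bsub>seq_ring\<^esub> a \<in> max_ideal \<xi>" "a \<otimes>\<^bsub>seq_ring\<^esub> x \<in> max_ideal \<xi>" if "a \<in> max_ideal \<xi>" for a x
      using that xi_mono[of "{n. a n = 0}" "{n. x n = 0 \<or> a n = 0}"]
        xi_mono[of "{n. a n = 0}" "{n. a n = 0 \<or> x n = 0}"]
      by (auto simp: max_ideal_def seq_ring_def)
  qed (rule ring_axioms)
qed

lemma hclass_eq_iff: "hclass \<xi> u = hclass \<xi> v \<longleftrightarrow> \<xi> {n. u n = v n} = 1"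
proof -
  interpret ideal "max_ideal \<xi>" seq_ring by (rule ideal_max_ideal)
  have "hclass \<xi> u = hclass \<xi> v \<longleftrightarrow> u \<ominus>\<^bsub>seq_ring\<^esub> v \<in> max_ideal \<xi>"
    unfolding hclass_def
    by (rule quotient_eq_iff_same_a_r_cos[OF ideal_max_ideal, symmetric]) (auto simp: seq_ring_def)
  then show ?thesis
    by (auto simp: a_minus_def a_inv_seq_ring max_ideal_def) (auto simp: seq_ring_def)
qed

lemma hless_hclass_iff: "hless \<xi> (hclass \<xi> u) (hclass \<xi> v) \<longleftrightarrow> \<xi> {n. u n < v n} = 1"
proof
  assume "hless \<xi> (hclass \<xi> u) (hclass \<xi> v)"
  then obtain u' v' where *: "\<xi> {n. u n = u' n} = 1" "\<xi> {n. v n = v' n} = 1"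
    "\<xi> {n. u' n < v' n} = 1"
    by (auto simp: hless_def hclass_eq_iff)
  show "\<xi> {n. u n < v n} = 1"
    by (rule xi_mono[OF xi_Int[OF xi_Int[OF *(1,2)] *(3)]]) auto
qed (auto simp: hless_def)

lemma maximalideal_max_ideal: "maximalideal (max_ideal \<xi>) seq_ring"
proof (rule maximalidealI[OF ideal_max_ideal])
  show "carrier seq_ring \<noteq> max_ideal \<xi>"
  proof
    assume "carrier seq_ring = max_ideal \<xi>"
    then have "(\<lambda>n. 1) \<in> max_ideal \<xi>" by (auto simp: seq_ring_def)
    then show False using xi_UNIV xi_compl[of UNIV] by (auto simp: max_ideal_def)
  qed
next
  fix J assume J: "ideal J seq_ring" "max_ideal \<xi> \<subseteq> J" "J \<subseteq> carrier seq_ring"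
  interpret J: ideal J seq_ring by (rule J)
  show "J = max_ideal \<xi> \<or> J = carrier seq_ring"
  proof (cases "J \<subseteq> max_ideal \<xi>")
    case False
    then obtain u where u: "u \<in> J" "\<xi> {n. u n = 0} \<noteq> 1" by (auto simp: max_ideal_def)
    define w where "w = (\<lambda>n. if u n = 0 then 1 else 0 :: real)"
    have "\<xi> {n. u n \<noteq> 0} = 1"
      using u(2) xi_compl[of "{n. u n = 0}"] by (simp add: Collect_neg_eq)
    then have "w \<in> J" using J(2) by (auto simp: max_ideal_def w_def)
    moreover have "(\<lambda>n. inverse (u n)) \<otimes>\<^bsub>seq_ring\<^esub> u \<in> J"
      by (rule J.I_l_closed[OF u(1)]) (simp add: seq_ring_def)
    ultimately have "w \<oplus>\<^bsub>seq_ring\<^esub> ((\<lambda>n. inverse (u n)) \<otimes>\<^bsub>seq_ring\<^esub> u) \<in> J"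
      by (rule additive_subgroup.a_closed[OF J.additive_subgroup_axioms])
    also have "w \<oplus>\<^bsub>seq_ring\<^esub> ((\<lambda>n. inverse (u n)) \<otimes>\<^bsub>seq_ring\<^esub> u) = \<one>\<^bsub>seq_ring\<^esub>"
      by (auto simp: seq_ring_def w_def)
    finally show ?thesis using J.one_imp_carrier by blast
  qed (use J in blast)
qed

lemma field_hyperreals: "field (hyperreals \<xi>)"
  unfolding hyperreals_def
  by (rule maximalideal.quotient_is_field[OF maximalideal_max_ideal cring_seq_ring])

end

end

theory Submission
  imports Defs
begin

text \<open>For \<open>Q \<noteq> \<zero>\<close>, adequality of \<open>P\<close> and \<open>Q\<close> is a condition on the single element \<open>P / Q\<close>.
  The hyperreals form a field (\<open>field_hyperreals\<close>), so dividing both terms by \<open>E \<noteq> \<zero>\<close> leaves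
  this element unchanged (\<open>quotient_cancel_common_divisor\<close>), hence still infinitely close to
  one, and the denominator \<open>Q / E\<close> is nonzero because a field has no zero divisors.
  In the degenerate case \<open>P\<close> and \<open>Q\<close> are both zero, and so are both quotients.\<close>

lemma (in field) quotient_cancel_common_divisor:
  assumes a: "a \<in> carrier R" and b: "b \<in> carrier R" "b \<noteq> \<zero>"
    and e: "e \<in> carrier R" "e \<noteq> \<zero>"
  shows "(a \<otimes> inv e) \<otimes> inv (b \<otimes> inv e) = a \<otimes> inv b"
proof -
  have units: "b \<in> Units R" "e \<in> Units R"
    using b e by (auto simp: field_Units)
  note closed = a b(1) e(1) units[THEN Units_inv_closed]
  have cancel: "inv e \<otimes> e = \<one>"
    using units by simp
  have "(b \<otimes> inv e) \<otimes> (inv b \<otimes> e) = (b \<otimes> inv b) \<otimes> (inv e \<otimes> e)"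
    using closed by (simp only: m_ac m_closed)
  also have "\<dots> = \<one>"
    using units cancel by simp
  finally have "inv (b \<otimes> inv e) = inv b \<otimes> e"
    using closed by (intro comm_inv_char) auto
  then have "(a \<otimes> inv e) \<otimes> inv (b \<otimes> inv e) = (a \<otimes> inv b) \<otimes> (inv e \<otimes> e)"
    using closed by (simp only: m_ac m_closed)
  also have "\<dots> = a \<otimes> inv b"
    using closed cancel by simp
  finally show ?thesis .
qed

theorem theorem1p7:
  fixes \<xi> :: "nat set \<Rightarrow> real" and P Q E :: "(nat \<Rightarrow> real) set"
  assumes "free_two_valued_measure \<xi>"
    and "P \<in> carrier (hyperreals \<xi>)"
    and "Q \<in> carrier (hyperreals \<xi>)"
    and "E \<in> carrier (hyperreals \<xi>)"
    and "E \<noteq> \<zero>\<^bsub>hyperreals \<xi>\<^esub>"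
    and "adequal \<xi> P Q"
  shows "adequal \<xi> (hdivide \<xi> P E) (hdivide \<xi> Q E)"
proof -
  interpret field "hyperreals \<xi>"
    by (rule field_hyperreals[OF assms(1)])
  have "E \<in> Units (hyperreals \<xi>)"
    using assms(4,5) by (auto simp: field_Units)
  then have invE: "inv\<^bsub>hyperreals \<xi>\<^esub> E \<in> Units (hyperreals \<xi>)"
    by (rule Units_inv_Units)
  show ?thesis
  proof (cases "Q = \<zero>\<^bsub>hyperreals \<xi>\<^esub>")
    case True
    then have "P = \<zero>\<^bsub>hyperreals \<xi>\<^esub>"
      using assms(6) by (auto simp: adequal_def)
    with True invE show ?thesis
      by (simp add: adequal_def hdivide_def Units_closed)
  next
    case False
    have "hdivide \<xi> Q E \<noteq> \<zero>\<^bsub>hyperreals \<xi>\<^esub>"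
      using False invE assms(3) integral by (auto simp: hdivide_def field_Units)
    moreover have "hdivide \<xi> (hdivide \<xi> P E) (hdivide \<xi> Q E) = hdivide \<xi> P Q"
      using quotient_cancel_common_divisor[OF assms(2,3) False assms(4,5)]
      by (simp add: hdivide_def)
    ultimately show ?thesis
      using False assms(6) by (simp add: adequal_def)
  qed
qed

end
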